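(* Let $G$ be an $r$-cop-win graph ($r\in\{0,1\}$) of finite corner rank $\alpha\ge 2$. Then Lower Way strategies and Catching strategies exist on $G$. Furthermore, if the cop follows a Lower Way strategy or a Catching strategy, the cop wins in at most $\alpha-r$ moves.
   Context: All graphs are finite, nonempty and reflexive (every vertex adjacent to itself). For distinct vertices $v,w$ of a graph $H$: $w$ corners $v$ in $H$ if every vertex of $H$ adjacent to $v$ is adjacent to $w$; $w$ strictly corners $v$ in $H$ if moreover some vertex of $H$ adjacent to $w$ is not adjacent to $v$; a strict corner of $H$ is a vertex strictly cornered in $H$ by another vertex. We also say $c$ corners $x$ in $H$ when $c=x$. Corner ranking: $G_1=G$, $k=1$. If $G_k$ is a clique, its vertices get rank $k$; stop. Else if $G_k$ has no strict corners, its vertices get rank $\infty$; stop. Else the set $X$ of strict corners of $G_k$ gets rank $k$, $G_{k+1}=G_k-X$, increase $k$, repeat. $\mathrm{cr}(v)$ denotes the rank of $v$ and $\mathrm{cr}(G)$ the maximum rank. For finite corner rank $\alpha\ge2$: $G$ is $1$-cop-win if some (equivalently every) vertex of rank $\alpha$ is adjacent to all vertices of $G_{\alpha-1}$, otherwise $0$-cop-win. Projections: for $k$ with $G_{k+1}$ defined, $f_k(\{u\})=\{u\}$ if $\mathrm{cr}(u)>k$, and otherwise the set of vertices of $G_{k+1}$ that strictly corner $u$ in $G_k$ ($u\in V(G_k)$); $f_k(S)=\bigcup_{u\in S}f_k(\{u\})$. $F_1$ is the identity on nonempty subsets of $V(G)$, $F_k=f_{k-1}\circ\cdots\circ f_1$,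 and $F_k(v)=F_k(\{v\})$. Game: cop places, robber places, then alternate moves with the cop first; a move is staying or moving to an adjacent vertex; cop wins when both share a vertex. With the cop at $c$ and robber at $x$: $x$ is $0$-cornered if $c=x$; for $k\ge1$, $x$ is $k$-cornered by $c$ if some $x'\in F_k(x)$ is cornered by $c$ in the subgraph induced by $V(G_k)\cup\{c\}$. The cop has $k$-caught the robber ($k\ge1$) if $c\in F_k(x)$. An initial cop placement is standard if that vertex is adjacent to every vertex of $G_{\alpha-r}$. A Lower Way strategy: standard initial placement, and for every $t\ge1$, after $t$ cop moves the cop $k$-corners the robber for some $k\le\alpha-r-t$. A Catching strategy: standard initial placement, and for every $t\ge1$, after $t$ cop moves the cop has $k$-caught the robber for some $k\le\alpha-r-t+1$. *)

theory Defs
  imports Main "HOL-Library.Extended_Nat"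
begin

text \<open>
  Graphs are given by a vertex set \<open>V\<close> and an adjacency relation \<open>E\<close>. All graphs derived from
  \<open>(V, E)\<close> below are induced subgraphs, and are represented by their vertex set \<open>W\<close>.
\<close>

definition reflexive_graph :: "'a set \<Rightarrow> ('a \<times> 'a) set \<Rightarrow> bool" where
  "reflexive_graph V E \<longleftrightarrow>
     finite V \<and> V \<noteq> {} \<and> E \<subseteq> V \<times> V \<and> sym E \<and> refl_on V E"

definition clique :: "('a \<times> 'a) set \<Rightarrow> 'a set \<Rightarrow> bool" where
  "clique E W \<longleftrightarrow> (\<forall>u\<in>W. \<forall>v\<in>W. (u, v) \<in> E)"

definition adjacent_to_all :: "('a \<times> 'a) set \<Rightarrow> 'a \<Rightarrow> 'a set \<Rightarrow> bool" where
  "adjacent_to_all E w W \<longleftrightarrow> (\<forall>u\<in>W. (w, u) \<in> E)"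

text \<open>Every vertex corners itself, in accordance with the convention for \<open>c = x\<close>.\<close>

definition corners :: "('a \<times> 'a) set \<Rightarrow> 'a set \<Rightarrow> 'a \<Rightarrow> 'a \<Rightarrow> bool" where
  "corners E W w v \<longleftrightarrow> w \<in> W \<and> v \<in> W \<and> (\<forall>u\<in>W. (u, v) \<in> E \<longrightarrow> (u, w) \<in> E)"

definition strictly_corners :: "('a \<times> 'a) set \<Rightarrow> 'a set \<Rightarrow> 'a \<Rightarrow> 'a \<Rightarrow> bool" where
  "strictly_corners E W w v \<longleftrightarrow>
     w \<noteq> v \<and> corners E W w v \<and> (\<exists>u\<in>W. (u, w) \<in> E \<and> (u, v) \<notin> E)"

definition strict_corners :: "('a \<times> 'a) set \<Rightarrow> 'a set \<Rightarrow> 'a set" where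
  "strict_corners E W = {v \<in> W. \<exists>w\<in>W. strictly_corners E W w v}"

text \<open>
  The vertex set of $G_k$, for \<open>k \<ge> 1\<close>. The ranking procedure stops at a graph without strict
  corners (a clique has none), so from there on this sequence is constant; indices at which $G_k$
  is undefined merely repeat the last graph.
\<close>

definition stage :: "'a set \<Rightarrow> ('a \<times> 'a) set \<Rightarrow> nat \<Rightarrow> 'a set" where
  "stage V E k = ((\<lambda>W. W - strict_corners E W) ^^ (k - 1)) V"

text \<open>
  A vertex gets the finite rank \<open>k\<close> if it is a strict corner of $G_k$ or if $G_k$ is the clique at
  which the procedure stops. The least such \<open>k\<close> is taken because of the repetitions of the final
  clique. The vertices left are those of a final graph which is not a clique.
\<close>

definition gets_rank :: "'a set \<Rightarrow> ('a \<times> 'a) set \<Rightarrow> 'a \<Rightarrow> nat \<Rightarrow> bool" where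
  "gets_rank V E v k \<longleftrightarrow>
     1 \<le> k \<and> v \<in> stage V E k \<and>
     (clique E (stage V E k) \<or> v \<in> strict_corners E (stage V E k))"

definition vertex_rank :: "'a set \<Rightarrow> ('a \<times> 'a) set \<Rightarrow> 'a \<Rightarrow> enat" where
  "vertex_rank V E v =
     (if \<exists>k. gets_rank V E v k then enat (LEAST k. gets_rank V E v k) else \<infinity>)"

definition corner_rank :: "'a set \<Rightarrow> ('a \<times> 'a) set \<Rightarrow> enat" where
  "corner_rank V E = Max (vertex_rank V E ` V)"

definition r_cop_win :: "'a set \<Rightarrow> ('a \<times> 'a) set \<Rightarrow> nat \<Rightarrow> bool" where
  "r_cop_win V E r \<longleftrightarrow>
     (\<exists>\<alpha>\<ge>2. corner_rank V E = enat \<alpha> \<and>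
        r = (if \<exists>w\<in>V. vertex_rank V E w = enat \<alpha> \<and> adjacent_to_all E w (stage V E (\<alpha> - 1))
             then 1 else 0))"

text \<open>The functions $f_k$ and $F_k$.\<close>

definition proj_vertex :: "'a set \<Rightarrow> ('a \<times> 'a) set \<Rightarrow> nat \<Rightarrow> 'a \<Rightarrow> 'a set" where
  "proj_vertex V E k u =
     (if vertex_rank V E u > enat k then {u}
      else {w \<in> stage V E (Suc k). strictly_corners E (stage V E k) w u})"

definition proj_step :: "'a set \<Rightarrow> ('a \<times> 'a) set \<Rightarrow> nat \<Rightarrow> 'a set \<Rightarrow> 'a set" where
  "proj_step V E k S = (\<Union>u\<in>S. proj_vertex V E k u)"

definition projection :: "'a set \<Rightarrow> ('a \<times> 'a) set \<Rightarrow> nat \<Rightarrow> 'a set \<Rightarrow> 'a set" where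
  "projection V E k S = fold (proj_step V E) [1..<k] S"

definition k_corners :: "'a set \<Rightarrow> ('a \<times> 'a) set \<Rightarrow> nat \<Rightarrow> 'a \<Rightarrow> 'a \<Rightarrow> bool" where
  "k_corners V E k c x \<longleftrightarrow>
     (if k = 0 then c = x
      else \<exists>x'\<in>projection V E k {x}. corners E (stage V E k \<union> {c}) c x')"

definition k_caught :: "'a set \<Rightarrow> ('a \<times> 'a) set \<Rightarrow> nat \<Rightarrow> 'a \<Rightarrow> 'a \<Rightarrow> bool" where
  "k_caught V E k c x \<longleftrightarrow> 1 \<le> k \<and> c \<in> projection V E k {x}"

text \<open>
  A cop strategy \<open>\<sigma>\<close> maps the list of the robber's positions so far to the cop's next position;
  \<open>\<sigma> []\<close> is the initial placement. (The cop's own earlier positions are determined by \<open>\<sigma>\<close> and the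
  robber's positions.) The robber's placement and successive positions are \<open>x 0, x 1, \<dots>\<close>, so the
  vertices are chosen in the order \<open>cop_at \<sigma> x 0, x 0, cop_at \<sigma> x 1, x 1, \<dots>\<close>, and after \<open>t \<ge> 1\<close>
  cop moves the cop is at \<open>cop_at \<sigma> x t\<close> and the robber at \<open>x (t - 1)\<close>. What \<open>x\<close> and \<open>\<sigma>\<close> do after
  the robber has been captured is irrelevant.
\<close>

definition robber_walk :: "'a set \<Rightarrow> ('a \<times> 'a) set \<Rightarrow> (nat \<Rightarrow> 'a) \<Rightarrow> bool" where
  "robber_walk V E x \<longleftrightarrow> x 0 \<in> V \<and> (\<forall>n. (x n, x (Suc n)) \<in> E)"

definition cop_at :: "('a list \<Rightarrow> 'a) \<Rightarrow> (nat \<Rightarrow> 'a) \<Rightarrow> nat \<Rightarrow> 'a" where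
  "cop_at \<sigma> x t = \<sigma> (map x [0..<t])"

text \<open>
  Cop and robber share a vertex after \<open>t\<close> cop moves, either right after the \<open>t\<close>-th cop move or
  because the robber then moves (for \<open>t = 0\<close>: is placed) onto the cop.
\<close>

definition captured_in_round :: "('a list \<Rightarrow> 'a) \<Rightarrow> (nat \<Rightarrow> 'a) \<Rightarrow> nat \<Rightarrow> bool" where
  "captured_in_round \<sigma> x t \<longleftrightarrow>
     (1 \<le> t \<and> cop_at \<sigma> x t = x (t - 1)) \<or> cop_at \<sigma> x t = x t"

text \<open>The game has not ended before the \<open>t\<close>-th cop move, so that this move takes place.\<close>

definition cop_makes_move :: "('a list \<Rightarrow> 'a) \<Rightarrow> (nat \<Rightarrow> 'a) \<Rightarrow> nat \<Rightarrow> bool" where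
  "cop_makes_move \<sigma> x t \<longleftrightarrow> 1 \<le> t \<and> (\<forall>s<t. \<not> captured_in_round \<sigma> x s)"

definition cop_strategy :: "'a set \<Rightarrow> ('a \<times> 'a) set \<Rightarrow> ('a list \<Rightarrow> 'a) \<Rightarrow> bool" where
  "cop_strategy V E \<sigma> \<longleftrightarrow>
     \<sigma> [] \<in> V \<and>
     (\<forall>x t. robber_walk V E x \<longrightarrow> cop_makes_move \<sigma> x t \<longrightarrow>
        (cop_at \<sigma> x (t - 1), cop_at \<sigma> x t) \<in> E)"

definition wins_within :: "'a set \<Rightarrow> ('a \<times> 'a) set \<Rightarrow> ('a list \<Rightarrow> 'a) \<Rightarrow> nat \<Rightarrow> bool" where
  "wins_within V E \<sigma> m \<longleftrightarrow>
     (\<forall>x. robber_walk V E x \<longrightarrow> (\<exists>t\<le>m. captured_in_round \<sigma> x t))"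

definition standard_placement :: "'a set \<Rightarrow> ('a \<times> 'a) set \<Rightarrow> nat \<Rightarrow> nat \<Rightarrow> 'a \<Rightarrow> bool" where
  "standard_placement V E \<alpha> r c \<longleftrightarrow> c \<in> V \<and> adjacent_to_all E c (stage V E (\<alpha> - r))"

text \<open>
  The bounds $k \le \alpha - r - t$ and $k \le \alpha - r - t + 1$ on \<open>k\<close> are bounds in the integers
  (for large \<open>t\<close> no \<open>k\<close> satisfies them), so \<open>t\<close> is moved to the left-hand side.
\<close>

definition lower_way_strategy ::
  "'a set \<Rightarrow> ('a \<times> 'a) set \<Rightarrow> nat \<Rightarrow> nat \<Rightarrow> ('a list \<Rightarrow> 'a) \<Rightarrow> bool" where
  "lower_way_strategy V E \<alpha> r \<sigma> \<longleftrightarrow>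
     cop_strategy V E \<sigma> \<and> standard_placement V E \<alpha> r (\<sigma> []) \<and>
     (\<forall>x t. robber_walk V E x \<longrightarrow> cop_makes_move \<sigma> x t \<longrightarrow>
        (\<exists>k. k + t \<le> \<alpha> - r \<and> k_corners V E k (cop_at \<sigma> x t) (x (t - 1))))"

definition catching_strategy ::
  "'a set \<Rightarrow> ('a \<times> 'a) set \<Rightarrow> nat \<Rightarrow> nat \<Rightarrow> ('a list \<Rightarrow> 'a) \<Rightarrow> bool" where
  "catching_strategy V E \<alpha> r \<sigma> \<longleftrightarrow>
     cop_strategy V E \<sigma> \<and> standard_placement V E \<alpha> r (\<sigma> []) \<and>
     (\<forall>x t. robber_walk V E x \<longrightarrow> cop_makes_move \<sigma> x t \<longrightarrow>
        (\<exists>k. k + t \<le> \<alpha> - r + 1 \<and> k_caught V E k (cop_at \<sigma> x t) (x (t - 1))))"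

end

theory Submission
  imports Defs
begin

text \<open>
  If \<open>x\<close> and \<open>y\<close> are adjacent, then every vertex of $F_k(x)$ is adjacent to every vertex of
  $F_k(y)$. More is true: if \<open>c\<close> lies in $F_{k+1}(x)$, it corners some \<open>w\<close> in $F_k(x)$ within $G_k$,
  and every vertex of $F_k(y)$ is adjacent to \<open>w\<close>, hence to \<open>c\<close>. So a cop who has \<open>k + 1\<close>-caught
  the robber can \<open>k\<close>-catch him after his next move. From a standard placement this starts with
  $F_{\alpha-r}$ and ends with $F_1$, that is, with a capture. A cop who has \<open>k + 1\<close>-caught the robber
  also \<open>k\<close>-corners him, so this Catching strategy is a Lower Way strategy as well.
\<close>

section \<open>Stages, projections and ranks\<close>

lemma stage_1: "stage V E (Suc 0) = V"
  by (simp add: stage_def)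

lemma stage_Suc: "1 \<le> k \<Longrightarrow> stage V E (Suc k) = stage V E k - strict_corners E (stage V E k)"
  by (cases k) (simp_all add: stage_def)

lemma stage_antimono:
  assumes "1 \<le> j" "j \<le> k"
  shows "stage V E k \<subseteq> stage V E j"
  using assms(2,1) by (induction k rule: dec_induct) (auto simp: stage_Suc)

lemma stage_subset: "1 \<le> k \<Longrightarrow> stage V E k \<subseteq> V"
  using stage_antimono[of 1 k V E] by (simp add: stage_1)

lemma projection_1: "projection V E (Suc 0) S = S"
  by (simp add: projection_def)

lemma projection_Suc:
  "1 \<le> k \<Longrightarrow> projection V E (Suc k) S = proj_step V E k (projection V E k S)"
  by (simp add: projection_def)

text \<open>Disposes of \<open>LEAST\<close> and of infinite rank in one formula, so that later rank
  comparisons only involve \<open>gets_rank\<close>.\<close>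

lemma less_vertex_rank_iff: "enat k < vertex_rank V E v \<longleftrightarrow> (\<forall>j\<le>k. \<not> gets_rank V E v j)"
proof (cases "\<exists>j. gets_rank V E v j")
  case True
  then have "gets_rank V E v (LEAST j. gets_rank V E v j)"
    by (rule LeastI_ex)
  then have "k < (LEAST j. gets_rank V E v j) \<longleftrightarrow> (\<forall>j\<le>k. \<not> gets_rank V E v j)"
    using not_less_Least le_less_trans by (metis not_le)
  then show ?thesis
    using True by (simp add: vertex_rank_def)
qed (simp add: vertex_rank_def)

section \<open>Strict cornering\<close>

lemma strictly_corners_trans:
  assumes "strictly_corners E W a b" "strictly_corners E W b c"
  shows "strictly_corners E W a c"
  using assms by (auto simp: strictly_corners_def corners_def)

lemma strictly_corners_card_less:
  assumes "finite W" "strictly_corners E W w v"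
  shows "card {u \<in> W. (u, v) \<in> E} < card {u \<in> W. (u, w) \<in> E}"
  using assms by (intro psubset_card_mono) (auto simp: strictly_corners_def corners_def)

text \<open>Among the vertices strictly cornering \<open>v\<close>, one of maximal degree in
  \<open>W\<close> works: a vertex strictly cornering it would, by transitivity, also strictly
  corner \<open>v\<close>, and its degree would be larger.\<close>

lemma strict_corner_has_nonstrict_cornering:
  assumes "finite W" "v \<in> strict_corners E W"
  obtains w where "w \<in> W - strict_corners E W" "strictly_corners E W w v"
proof -
  let ?A = "{w \<in> W. strictly_corners E W w v}"
  let ?d = "\<lambda>w. card {u \<in> W. (u, w) \<in> E}"
  have "finite ?A" "?A \<noteq> {}"
    using assms by (auto simp: strict_corners_def)
  then obtain w where w: "w \<in> ?A" "Max (?d ` ?A) = ?d w"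
    by (rule obtains_MAX)
  have max: "?d w' \<le> ?d w" if "w' \<in> ?A" for w'
    unfolding w(2)[symmetric] using \<open>finite ?A\<close> that by (intro Max_ge) blast+
  have "w \<notin> strict_corners E W"
  proof
    assume "w \<in> strict_corners E W"
    then obtain w' where w': "w' \<in> W" "strictly_corners E W w' w"
      by (auto simp: strict_corners_def)
    then have "w' \<in> ?A"
      using w(1) strictly_corners_trans by fast
    then show False
      using max strictly_corners_card_less[OF assms(1) w'(2)] by (simp add: leD)
  qed
  then show thesis
    using that w(1) by blast
qed

section \<open>Stages up to the corner rank\<close>

locale finite_corner_rank =
  fixes V :: "'a set" and E :: "('a \<times> 'a) set" and \<alpha> :: nat
  assumes graph: "reflexive_graph V E"
    and rank: "corner_rank V E = enat \<alpha>"
begin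

lemma finite_V: "finite V" and E_subset: "E \<subseteq> V \<times> V" and sym_E: "sym E"
  using graph by (auto simp: reflexive_graph_def)

lemma finite_stage: "1 \<le> k \<Longrightarrow> finite (stage V E k)"
  using finite_subset[OF stage_subset finite_V] .

lemma top_rank_vertex:
  obtains v where "v \<in> V" "vertex_rank V E v = enat \<alpha>"
proof -
  have "Max (vertex_rank V E ` V) \<in> vertex_rank V E ` V"
    using graph by (intro Max_in) (auto simp: reflexive_graph_def)
  then show thesis
    using that rank by (auto simp: corner_rank_def)
qed

lemma vertex_rank_le: "v \<in> V \<Longrightarrow> vertex_rank V E v \<le> enat \<alpha>"
  unfolding rank[symmetric] corner_rank_def using finite_V by (intro Max_ge) blast+

lemma vertex_rank_eqD:
  assumes "vertex_rank V E v = enat k"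
  shows "gets_rank V E v k" "\<And>j. j < k \<Longrightarrow> \<not> gets_rank V E v j"
  using assms by (auto simp: vertex_rank_def split: if_splits intro: LeastI dest: not_less_Least)

lemma top_rank_in_stage: "vertex_rank V E v = enat \<alpha> \<Longrightarrow> v \<in> stage V E \<alpha>"
  using vertex_rank_eqD(1) by (simp add: gets_rank_def)

lemma rank_pos: "1 \<le> \<alpha>"
  using top_rank_vertex vertex_rank_eqD(1) unfolding gets_rank_def by metis

text \<open>A vertex of rank \<alpha> survives in all these stages. In a clique at stage
  \<open>j\<close> it would have obtained the smaller rank \<open>j\<close>.\<close>

lemma stage_not_clique:
  assumes "1 \<le> j" "j < \<alpha>"
  shows "\<not> clique E (stage V E j)"
proof -
  obtain v where v: "v \<in> V" "vertex_rank V E v = enat \<alpha>"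
    by (rule top_rank_vertex)
  then have "v \<in> stage V E j"
    using top_rank_in_stage stage_antimono[of j \<alpha> V E] assms by auto
  then show ?thesis
    using vertex_rank_eqD(2)[OF v(2) assms(2)] assms(1) by (auto simp: gets_rank_def)
qed

lemma gets_rank_iff:
  assumes "1 \<le> j" "j < \<alpha>"
  shows "gets_rank V E v j \<longleftrightarrow> v \<in> stage V E j \<and> v \<notin> stage V E (Suc j)"
  using assms stage_not_clique by (auto simp: gets_rank_def stage_Suc)

text \<open>Links the rank test in \<open>proj_vertex\<close> to survival into the next stage. At
  \<open>k = \<alpha>\<close> this fails, because the final clique is repeated.\<close>

lemma vertex_rank_greater_iff:
  assumes "1 \<le> k" "k < \<alpha>" "v \<in> V"
  shows "vertex_rank V E v > enat k \<longleftrightarrow> v \<in> stage V E (Suc k)"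
proof -
  have "v \<in> stage V E (Suc k) \<longleftrightarrow> (\<forall>j\<in>{1..k}. \<not> gets_rank V E v j)"
    using assms(1,2)
  proof (induction k rule: dec_induct)
    case base
    then show ?case
      using assms(3) by (simp add: gets_rank_iff stage_1)
  next
    case (step k)
    then have "v \<in> stage V E (Suc (Suc k)) \<longleftrightarrow>
        v \<in> stage V E (Suc k) \<and> \<not> gets_rank V E v (Suc k)"
      using stage_antimono[of "Suc k" "Suc (Suc k)" V E] by (auto simp: gets_rank_iff)
    then show ?case
      using step by (simp add: atLeastAtMostSuc_conv conj_commute)
  qed
  also have "\<dots> \<longleftrightarrow> vertex_rank V E v > enat k"
    unfolding less_vertex_rank_iff by (auto simp: gets_rank_def)
  finally show ?thesis ..
qed

text \<open>Ranks are at most \<alpha> and vertices of smaller rank are gone by then, so if this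
  stage were not a clique, all its vertices would be strict corners. But a strict corner is strictly
  cornered by some vertex that is not one.\<close>

lemma clique_top_stage: "clique E (stage V E \<alpha>)"
proof (rule ccontr)
  assume not_clique: "\<not> clique E (stage V E \<alpha>)"
  have corner: "v \<in> strict_corners E (stage V E \<alpha>)" if v: "v \<in> stage V E \<alpha>" for v
  proof -
    have "v \<in> V"
      using v by (rule subsetD[OF stage_subset[OF rank_pos]])
    then obtain k where k: "vertex_rank V E v = enat k" "k \<le> \<alpha>"
      using vertex_rank_le enat_ile by fastforce
    have "k = \<alpha>"
    proof (rule ccontr)
      assume "k \<noteq> \<alpha>"
      then have "1 \<le> k" "k < \<alpha>"
        using k vertex_rank_eqD(1)[OF k(1)] by (auto simp: gets_rank_def)
      then have "v \<notin> stage V E (Suc k)"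
        using vertex_rank_eqD(1)[OF k(1)] gets_rank_iff by blast
      with \<open>k < \<alpha>\<close> show False
        using v stage_antimono[of "Suc k" \<alpha> V E] by auto
    qed
    then show ?thesis
      using vertex_rank_eqD(1)[OF k(1)] not_clique by (simp add: gets_rank_def)
  qed
  obtain v where "v \<in> stage V E \<alpha>"
    using not_clique by (auto simp: clique_def)
  then show False
    using corner strict_corner_has_nonstrict_cornering[OF finite_stage[OF rank_pos]] by blast
qed

section \<open>Nonemptiness and adjacency of projections\<close>

lemma proj_vertex_corners:
  assumes "1 \<le> k" "k < \<alpha>" "u \<in> stage V E k" "w \<in> proj_vertex V E k u"
  shows "w \<in> stage V E (Suc k)" "corners E (stage V E k) w u"
proof -
  have "u \<in> V"
    using assms(3) by (rule subsetD[OF stage_subset[OF assms(1)]])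
  then show "w \<in> stage V E (Suc k)" "corners E (stage V E k) w u"
    using assms vertex_rank_greater_iff[of k u]
    by (auto simp: proj_vertex_def strictly_corners_def corners_def split: if_splits)
qed

text \<open>A removed vertex needs a strictly cornering vertex that survives into the next stage,
  hence one that is itself no strict corner.\<close>

lemma proj_vertex_nonempty:
  assumes "1 \<le> k" "k < \<alpha>" "u \<in> stage V E k"
  shows "proj_vertex V E k u \<noteq> {}"
proof (cases "vertex_rank V E u > enat k")
  case False
  have "u \<in> V"
    using assms(3) by (rule subsetD[OF stage_subset[OF assms(1)]])
  then have "u \<in> strict_corners E (stage V E k)"
    using False assms vertex_rank_greater_iff[of k u] by (auto simp: stage_Suc)
  then obtain w where "w \<in> stage V E k - strict_corners E (stage V E k)"
    "strictly_corners E (stage V E k) w u"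
    using strict_corner_has_nonstrict_cornering[OF finite_stage[OF assms(1)]] by blast
  then show ?thesis
    using False assms(1) by (auto simp: proj_vertex_def stage_Suc)
qed (simp add: proj_vertex_def)

lemma projection_nonempty_subset:
  assumes "1 \<le> k" "k \<le> \<alpha>" "x \<in> V"
  shows "projection V E k {x} \<noteq> {} \<and> projection V E k {x} \<subseteq> stage V E k"
  using assms(1,2)
proof (induction k rule: dec_induct)
  case base
  then show ?case
    using assms(3) by (simp add: projection_1 stage_1)
next
  case (step k)
  then show ?case
    using proj_vertex_nonempty[of k] proj_vertex_corners(1)[of k]
    by (fastforce simp: projection_Suc proj_step_def)
qed

lemma projection_Suc_corners:
  assumes "1 \<le> k" "k < \<alpha>" "x \<in> V" "c \<in> projection V E (Suc k) {x}"
  obtains w where "w \<in> projection V E k {x}" "corners E (stage V E k) c w"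
  using assms proj_vertex_corners(2)[of k] projection_nonempty_subset[of k x]
  by (fastforce simp: projection_Suc proj_step_def)

text \<open>Adjacency at level \<open>k\<close> is a hypothesis because the lemma serves twice:
  within the induction for \<open>projection_adjacent\<close>, and then in
  \<open>projection_step\<close>.\<close>

lemma projection_Suc_adjacent:
  assumes "1 \<le> k" "k < \<alpha>" "x \<in> V" "y \<in> V"
    and adj: "\<And>v w. v \<in> projection V E k {x} \<Longrightarrow> w \<in> projection V E k {y} \<Longrightarrow> (v, w) \<in> E"
    and c: "c \<in> projection V E (Suc k) {x}" and z: "z \<in> projection V E k {y}"
  shows "(c, z) \<in> E"
proof -
  obtain w where w: "w \<in> projection V E k {x}" "corners E (stage V E k) c w"
    using projection_Suc_corners[OF assms(1-3) c] .
  have "z \<in> stage V E k"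
    using z projection_nonempty_subset[of k y] assms by auto
  then show ?thesis
    using adj[OF w(1) z] w(2) sym_E by (auto simp: corners_def dest: symD)
qed

text \<open>The induction step raises the two sides one after the other: first \<open>x\<close>
  through \<open>projection_Suc_adjacent\<close>, then \<open>y\<close>.\<close>

lemma projection_adjacent:
  assumes "1 \<le> k" "k \<le> \<alpha>" "(x, y) \<in> E"
    and "v \<in> projection V E k {x}" "w \<in> projection V E k {y}"
  shows "(v, w) \<in> E"
  using assms(1,2,4,5)
proof (induction k arbitrary: v w rule: dec_induct)
  case base
  then show ?case
    using assms(3) by (simp add: projection_1)
next
  case (step k)
  have xy: "x \<in> V" "y \<in> V"
    using assms(3) E_subset by auto
  have k: "1 \<le> k" "k < \<alpha>"
    using step by auto
  obtain w' where w': "w' \<in> projection V E k {y}" "corners E (stage V E k) w w'"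
    using projection_Suc_corners[OF k xy(2) step.prems(3)] .
  \<comment> \<open>The vertex \<open>v\<close> is taken back from stage \<open>Suc k\<close> to
    stage \<open>k\<close>, where \<open>w\<close> corners \<open>w'\<close>.\<close>
  have "v \<in> stage V E k"
    using projection_nonempty_subset[of "Suc k" x] stage_antimono[of k "Suc k" V E] k xy step.prems
    by auto
  moreover have "(v, w') \<in> E"
    using projection_Suc_adjacent[OF k xy _ step.prems(2) w'(1)] step.IH k by simp
  ultimately show ?case
    using w'(2) by (simp add: corners_def)
qed

lemma projection_step:
  assumes "1 \<le> k" "k < \<alpha>" "(x, y) \<in> E"
    and "c \<in> projection V E (Suc k) {x}" "z \<in> projection V E k {y}"
  shows "(c, z) \<in> E"
  using projection_Suc_adjacent[of k x y c z] projection_adjacent[of k x y] assms E_subset by auto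

lemma k_caught_imp_k_corners:
  assumes "k < \<alpha>" "x \<in> V" "k_caught V E (Suc k) c x"
  shows "k_corners V E k c x"
proof (cases "k = 0")
  case True
  then show ?thesis
    using assms(3) by (simp add: k_caught_def k_corners_def projection_1)
next
  case False
  then obtain w where w: "w \<in> projection V E k {x}" "corners E (stage V E k) c w"
    using projection_Suc_corners[of k x c] assms by (auto simp: k_caught_def)
  \<comment> \<open>The vertex \<open>c\<close> is already in stage \<open>k\<close>, so adding it
    in \<open>k_corners\<close> changes nothing.\<close>
  moreover from w(2) have "stage V E k \<union> {c} = stage V E k"
    by (auto simp: corners_def)
  ultimately show ?thesis
    using False by (auto simp: k_corners_def)
qed

section \<open>Initial placement and the Catching strategy\<close>

lemma standard_placement_exists:
  assumes "r_cop_win V E r"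
  obtains c where "standard_placement V E \<alpha> r c"
proof -
  let ?P = "\<exists>w\<in>V. vertex_rank V E w = enat \<alpha> \<and> adjacent_to_all E w (stage V E (\<alpha> - 1))"
  have r: "r = (if ?P then 1 else 0)"
    using assms unfolding r_cop_win_def rank by blast
  show thesis
  proof (cases ?P)
    case True
    with r have "r = 1"
      by (rule trans[OF _ if_P])
    then show thesis
      using True that by (auto simp: standard_placement_def)
  next
    case False
    with r have "r = 0"
      by (rule trans[OF _ if_not_P])
    moreover obtain v where "v \<in> V" "vertex_rank V E v = enat \<alpha>"
      by (rule top_rank_vertex)
    \<comment> \<open>For \<open>r = 0\<close> any vertex of rank \<alpha> serves, since the last
      stage is a clique.\<close>
    ultimately show thesis
      using that[of v] top_rank_in_stage clique_top_stage
      by (auto simp: standard_placement_def adjacent_to_all_def clique_def)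
  qed
qed

lemma robber_walk_in_V: "robber_walk V E x \<Longrightarrow> x n \<in> V"
  using E_subset by (cases n) (auto simp: robber_walk_def)

text \<open>With \<open>t\<close> robber positions known, the target level is
  \<open>m + 1 - t\<close>: level \<open>m\<close> at the first move, level 1 at move
  \<open>m\<close>. After that the game is over and the value does not matter.\<close>

definition projection_strategy :: "nat \<Rightarrow> 'a \<Rightarrow> 'a list \<Rightarrow> 'a" where
  "projection_strategy m c xs =
     (if xs = [] then c else SOME w. w \<in> projection V E (m + 1 - length xs) {last xs})"

lemma cop_at_projection_strategy:
  assumes "robber_walk V E x" "t < m" "m \<le> \<alpha>"
  shows "cop_at (projection_strategy m c) x (Suc t) \<in> projection V E (m - t) {x t}"
proof -
  have "projection V E (m - t) {x t} \<noteq> {}"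
    using projection_nonempty_subset[of "m - t" "x t"] robber_walk_in_V assms by simp
  then show ?thesis
    by (simp add: cop_at_def projection_strategy_def some_in_eq)
qed

lemma cop_makes_move_projection_strategy:
  assumes "robber_walk V E x" "cop_makes_move (projection_strategy m c) x t" "1 \<le> m" "m \<le> \<alpha>"
  shows "t \<le> m"
proof (rule ccontr)
  assume "\<not> t \<le> m"
  \<comment> \<open>Move \<open>m\<close> reaches level 1, where the projection is just the robber's
    position.\<close>
  moreover have "captured_in_round (projection_strategy m c) x m"
    using cop_at_projection_strategy[of x "m - 1" m c] assms
    by (simp add: captured_in_round_def projection_1)
  ultimately show False
    using assms(2) by (auto simp: cop_makes_move_def)
qed

lemma catching_projection_strategy:
  assumes c: "standard_placement V E \<alpha> r c" and r: "r < \<alpha>"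
  shows "catching_strategy V E \<alpha> r (projection_strategy (\<alpha> - r) c)"
proof -
  define m where "m = \<alpha> - r"
  define \<sigma> where "\<sigma> = projection_strategy m c"
  have m: "1 \<le> m" "m \<le> \<alpha>"
    using r by (auto simp: m_def)
  have start: "\<sigma> [] = c"
    by (simp add: \<sigma>_def projection_strategy_def)
  have adj: "(cop_at \<sigma> x (t - 1), cop_at \<sigma> x t) \<in> E"
    if x: "robber_walk V E x" and t: "1 \<le> t" "t \<le> m" for x t
  proof (cases "t = 1")
    case True
    \<comment> \<open>The first move is legal because the initial placement is adjacent to all of
      stage \<open>m\<close>.\<close>
    have "cop_at \<sigma> x 1 \<in> stage V E m"
      using cop_at_projection_strategy[OF x, of 0 m c] m robber_walk_in_V[OF x]
        projection_nonempty_subset[of m "x 0"] by (auto simp: \<sigma>_def)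
    then show ?thesis
      using True c start
      by (simp add: cop_at_def standard_placement_def adjacent_to_all_def m_def)
  next
    case False
    define s where "s = t - 2"
    have s: "t = Suc (Suc s)"
      using t(1) False by (simp add: s_def)
    \<comment> \<open>Later moves descend one level; \<open>Suc (m - Suc s)\<close> is
      \<open>m - s\<close> in the form that \<open>projection_step\<close> expects.\<close>
    have "cop_at \<sigma> x (Suc s) \<in> projection V E (Suc (m - Suc s)) {x s}"
      using cop_at_projection_strategy[OF x, of s m c] m s t by (simp add: \<sigma>_def Suc_diff_Suc)
    moreover have "cop_at \<sigma> x (Suc (Suc s)) \<in> projection V E (m - Suc s) {x (Suc s)}"
      using cop_at_projection_strategy[OF x, of "Suc s" m c] m s t by (simp add: \<sigma>_def)
    moreover have "(x s, x (Suc s)) \<in> E"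
      using x by (simp add: robber_walk_def)
    ultimately show ?thesis
      using projection_step[of "m - Suc s" "x s" "x (Suc s)"] s t m by simp
  qed
  have caught: "\<exists>k. k + t \<le> m + 1 \<and> k_caught V E k (cop_at \<sigma> x t) (x (t - 1))"
    if x: "robber_walk V E x" and t: "1 \<le> t" "t \<le> m" for x t
    using cop_at_projection_strategy[OF x, of "t - 1" m c] m t
    by (intro exI[of _ "m - (t - 1)"]) (auto simp: k_caught_def \<sigma>_def)
  \<comment> \<open>Both \<open>adj\<close> and \<open>caught\<close> cover only
    \<open>t \<le> m\<close>; the capture at move \<open>m\<close> rules out later moves.\<close>
  have "1 \<le> t \<and> t \<le> m" if "robber_walk V E x" "cop_makes_move \<sigma> x t" for x t
    using cop_makes_move_projection_strategy that m by (auto simp: \<sigma>_def cop_makes_move_def)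
  then have "catching_strategy V E \<alpha> r \<sigma>"
    using c start adj caught
    by (auto simp: catching_strategy_def cop_strategy_def standard_placement_def m_def)
  then show ?thesis
    by (simp add: \<sigma>_def m_def)
qed

section \<open>Lower Way strategies and the number of moves\<close>

lemma catching_imp_lower_way:
  assumes "catching_strategy V E \<alpha> r \<sigma>"
  shows "lower_way_strategy V E \<alpha> r \<sigma>"
  unfolding lower_way_strategy_def
proof (intro conjI allI impI)
  fix x t
  assume x: "robber_walk V E x" and t: "cop_makes_move \<sigma> x t"
  then obtain k where k: "k + t \<le> \<alpha> - r + 1" "k_caught V E k (cop_at \<sigma> x t) (x (t - 1))"
    using assms by (auto simp: catching_strategy_def)
  moreover have "1 \<le> t" "1 \<le> k"
    using t k(2) by (auto simp: cop_makes_move_def k_caught_def)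
  \<comment> \<open>Lowering the level by one absorbs the extra 1 in the Catching bound;
    \<open>1 \<le> t\<close> keeps \<open>k - 1\<close> below \<alpha>.\<close>
  ultimately have "k - 1 + t \<le> \<alpha> - r" "k - 1 < \<alpha>"
    by linarith+
  moreover have "k_corners V E (k - 1) (cop_at \<sigma> x t) (x (t - 1))"
    using k_caught_imp_k_corners[of "k - 1"] \<open>k - 1 < \<alpha>\<close> \<open>1 \<le> k\<close> k(2) robber_walk_in_V[OF x]
    by simp
  ultimately show "\<exists>k. k + t \<le> \<alpha> - r \<and> k_corners V E k (cop_at \<sigma> x t) (x (t - 1))"
    by blast
qed (use assms in \<open>auto simp: catching_strategy_def\<close>)

end

lemma lower_way_wins_within:
  assumes "lower_way_strategy V E \<alpha> r \<sigma>" "r < \<alpha>"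
  shows "wins_within V E \<sigma> (\<alpha> - r)"
  unfolding wins_within_def
proof (intro allI impI, rule ccontr)
  fix x
  assume x: "robber_walk V E x" and "\<not> (\<exists>t\<le>\<alpha> - r. captured_in_round \<sigma> x t)"
  then have "cop_makes_move \<sigma> x (\<alpha> - r)" and free: "\<not> captured_in_round \<sigma> x (\<alpha> - r)"
    using assms(2) by (auto simp: cop_makes_move_def)
  \<comment> \<open>At move \<open>\<alpha> - r\<close> the bound leaves only level 0, which means
    capture.\<close>
  then have "k_corners V E 0 (cop_at \<sigma> x (\<alpha> - r)) (x (\<alpha> - r - 1))"
    using assms(1) x by (fastforce simp: lower_way_strategy_def)
  then show False
    using free assms(2) by (auto simp: captured_in_round_def k_corners_def)
qed

theorem theorem4p12:
  fixes V :: "'a set" and E :: "('a \<times> 'a) set" and \<alpha> r :: nat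
  assumes "reflexive_graph V E"
    and "corner_rank V E = enat \<alpha>"
    and "2 \<le> \<alpha>"
    and "r \<in> {0, 1}"
    and "r_cop_win V E r"
  shows "(\<exists>\<sigma>. lower_way_strategy V E \<alpha> r \<sigma>) \<and>
         (\<exists>\<sigma>. catching_strategy V E \<alpha> r \<sigma>) \<and>
         (\<forall>\<sigma>. lower_way_strategy V E \<alpha> r \<sigma> \<or> catching_strategy V E \<alpha> r \<sigma> \<longrightarrow>
               wins_within V E \<sigma> (\<alpha> - r))"
proof -
  interpret finite_corner_rank V E \<alpha>
    using assms by unfold_locales
  have "r < \<alpha>"
    using assms by auto
  obtain c where "standard_placement V E \<alpha> r c"
    using standard_placement_exists[OF assms(5)] .
  then have "\<exists>\<sigma>. catching_strategy V E \<alpha> r \<sigma>"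
    using catching_projection_strategy[OF _ \<open>r < \<alpha>\<close>] by blast
  \<comment> \<open>Every Catching strategy is a Lower Way strategy, which settles both the second
    existence claim and the bound for Catching strategies.\<close>
  then show ?thesis
    using catching_imp_lower_way lower_way_wins_within[OF _ \<open>r < \<alpha>\<close>] by blast
qed

end
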